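(* Let $n\geq 3$ be a positive integer and let $R\cong \prod_{i=1}^{n}\mathbb{F}_{i}$, where $\mathbb{F}_{i}$ is a field for every $1\leq i\leq n$. Then $$In(R)_{SR}=H+\underbrace{K_{2}+\cdots+K_{2}}_{n\ \text{times}},$$ where $H$ is a connected graph.
   Context: For a commutative ring $R$ with identity, the inclusion ideal graph $In(R)$ is the simple graph whose vertices are all non-trivial ideals of $R$ (ideals different from $0$ and $R$), two distinct vertices being adjacent if and only if one of them is properly contained in the other. For a graph $G$ with distance $d$ and open neighborhoods $N(\cdot)$, two different vertices $u,v$ are mutually maximally distant if $d(v,w)\leq d(u,v)$ for every $w\in N(u)$ and $d(u,w)\leq d(u,v)$ for every $w\in N(v)$. The strong resolving graph $G_{SR}$ has as vertices those $u\in V(G)$ for which there is some $v\in V(G)$ such that $u,v$ are mutually maximally distant, and $u,v$ are adjacent in $G_{SR}$ if and only if they are mutually maximally distant in $G$. $K_2$ is the complete graph on two vertices, $+$ denotes disjoint union of graphs, and equality is up to isomorphism. The graph with no vertices is counted as connected. *)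

theory Defs
  imports
    "HOL-Algebra.Chinese_Remainder"
    "Graph_Theory.Graph_Theory"
begin

text \<open>
  A simple graph is a \<^locale>\<open>pair_bidirected_digraph\<close>: an edge between two vertices is
  represented by the two opposite arcs, and there are no loops.
\<close>

definition inclusion_ideal_graph :: "('a, 'm) ring_scheme \<Rightarrow> 'a set pair_pre_digraph" where
  "inclusion_ideal_graph R =
    (let V = {I. ideal I R \<and> I \<noteq> {\<zero>\<^bsub>R\<^esub>} \<and> I \<noteq> carrier R}
     in \<lparr> pverts = V, parcs = {(I, J). I \<in> V \<and> J \<in> V \<and> (I \<subset> J \<or> J \<subset> I)} \<rparr>)"

text \<open>
  The distance is the infimum of the lengths of the walks between two vertices,
  hence \<open>\<infinity>\<close> if there are none.
\<close>

definition graph_dist :: "'a pair_pre_digraph \<Rightarrow> 'a \<Rightarrow> 'a \<Rightarrow> ereal" where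
  "graph_dist G u v = wf_digraph.\<mu> (with_proj G) (\<lambda>_. 1) u v"

definition open_nbhd :: "'a pair_pre_digraph \<Rightarrow> 'a \<Rightarrow> 'a set" where
  "open_nbhd G u = {w. (u, w) \<in> parcs G}"

definition mutually_maximally_distant :: "'a pair_pre_digraph \<Rightarrow> 'a \<Rightarrow> 'a \<Rightarrow> bool" where
  "mutually_maximally_distant G u v \<longleftrightarrow>
     u \<in> pverts G \<and> v \<in> pverts G \<and> u \<noteq> v \<and>
     (\<forall>w \<in> open_nbhd G u. graph_dist G v w \<le> graph_dist G u v) \<and>
     (\<forall>w \<in> open_nbhd G v. graph_dist G u w \<le> graph_dist G u v)"

definition strong_resolving_graph :: "'a pair_pre_digraph \<Rightarrow> 'a pair_pre_digraph" where
  "strong_resolving_graph G =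
     \<lparr> pverts = {u \<in> pverts G. \<exists>v \<in> pverts G. mutually_maximally_distant G u v},
       parcs = {(u, v). mutually_maximally_distant G u v} \<rparr>"

definition complete_graph :: "nat \<Rightarrow> nat pair_pre_digraph" where
  "complete_graph m = \<lparr> pverts = {..<m}, parcs = {(i, j). i < m \<and> j < m \<and> i \<noteq> j} \<rparr>"

definition graph_sum :: "'a pair_pre_digraph \<Rightarrow> 'b pair_pre_digraph \<Rightarrow> ('a + 'b) pair_pre_digraph" where
  "graph_sum G H =
     \<lparr> pverts = pverts G <+> pverts H,
       parcs = map_prod Inl Inl ` parcs G \<union> map_prod Inr Inr ` parcs H \<rparr>"

text \<open>The disjoint union of \<open>n\<close> copies of one graph.\<close>

definition graph_copies :: "nat \<Rightarrow> 'a pair_pre_digraph \<Rightarrow> (nat \<times> 'a) pair_pre_digraph" where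
  "graph_copies n G =
     \<lparr> pverts = {..<n} \<times> pverts G,
       parcs = {((i, u), (j, v)). i < n \<and> i = j \<and> (u, v) \<in> parcs G} \<rparr>"

text \<open>
  Unlike \<^const>\<open>connected\<close>, which asks for a vertex, this predicate admits the graph
  without vertices.
\<close>

definition connected_simple_graph :: "'a pair_pre_digraph \<Rightarrow> bool" where
  "connected_simple_graph H \<longleftrightarrow>
     pair_bidirected_digraph H \<and> (pverts H = {} \<or> connected (with_proj H))"

definition graph_iso :: "'a pair_pre_digraph \<Rightarrow> 'b pair_pre_digraph \<Rightarrow> bool" where
  "graph_iso G H \<longleftrightarrow> digraph_iso (with_proj G) (with_proj H)"

lemma pair_bidirected_inclusion_ideal_graph: "pair_bidirected_digraph (inclusion_ideal_graph R)"
  by unfold_locales (auto simp: inclusion_ideal_graph_def symmetric_def Let_def intro: symI)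

lemma pair_bidirected_complete_graph: "pair_bidirected_digraph (complete_graph m)"
  by unfold_locales (auto simp: complete_graph_def symmetric_def intro: symI)

lemma complete_digraph_complete_graph: "complete_digraph m (with_proj (complete_graph m))"
  by (auto simp: complete_digraph_pair_def complete_graph_def)

lemma mutually_maximally_distant_verts:
  "mutually_maximally_distant G u v \<Longrightarrow> u \<in> pverts G \<and> v \<in> pverts G \<and> u \<noteq> v"
  by (simp add: mutually_maximally_distant_def)

lemma graph_dist_eq:
  assumes "pair_wf_digraph G"
  shows "graph_dist G u v = (INF p \<in> {p. pre_digraph.awalk (with_proj G) u p v}. ereal (real (length p)))"
proof -
  interpret wf_digraph "with_proj G" using assms by (simp add: wf_digraph_wp_iff)
  have "awalk_cost (\<lambda>_. 1) p = real (length p)" for p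
    by (induction p) auto
  then show ?thesis by (simp add: graph_dist_def \<mu>_def)
qed

lemma graph_iso_iff:
  assumes G: "pair_wf_digraph G" and H: "pair_wf_digraph H"
  shows "graph_iso G H \<longleftrightarrow>
    (\<exists>f. bij_betw f (pverts G) (pverts H) \<and>
         (\<forall>u \<in> pverts G. \<forall>v \<in> pverts G. (u, v) \<in> parcs G \<longleftrightarrow> (f u, f v) \<in> parcs H))"
proof
  assume "graph_iso G H"
  then obtain h where h: "pre_digraph.digraph_isomorphism (with_proj G) h"
    and eq: "with_proj H = app_iso h (with_proj G)"
    by (auto simp: graph_iso_def digraph_iso_def)
  define f where "f = iso_verts h"
  have inj: "inj_on f (pverts G)"
    using h by (simp add: pre_digraph.digraph_isomorphism_def f_def)
  have img: "pverts H = f ` pverts G"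
    using arg_cong[OF eq, of verts] by (simp add: f_def)
  have hd: "iso_tail h = fst" "iso_head h = snd"
    using arg_cong[OF eq, of tail] arg_cong[OF eq, of head] by simp_all
  have arc: "iso_arcs h (u, v) = (f u, f v)" if "(u, v) \<in> parcs G" for u v
    using h that hd by (auto simp: pre_digraph.digraph_isomorphism_def f_def prod_eq_iff)
  have arcs: "parcs H = iso_arcs h ` parcs G"
    using arg_cong[OF eq, of arcs] by simp
  have "(u, v) \<in> parcs G" if uv: "u \<in> pverts G" "v \<in> pverts G" "(f u, f v) \<in> parcs H" for u v
  proof -
    obtain a b where ab: "(a, b) \<in> parcs G" "(f u, f v) = iso_arcs h (a, b)"
      using uv(3) arcs by auto
    then have "a \<in> pverts G" "b \<in> pverts G"
      using pair_wf_digraph.in_arcsD1[OF G] pair_wf_digraph.in_arcsD2[OF G] by blast+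
    moreover have "f u = f a" "f v = f b" using ab arc by simp_all
    ultimately have "u = a" "v = b" using inj uv by (simp_all add: inj_on_eq_iff)
    with ab show ?thesis by simp
  qed
  moreover have "(f u, f v) \<in> parcs H" if "(u, v) \<in> parcs G" for u v
    using arc[OF that] imageI[OF that, of "iso_arcs h"] arcs by simp
  moreover have "bij_betw f (pverts G) (pverts H)"
    using inj img by (simp add: bij_betw_def)
  ultimately show "\<exists>f. bij_betw f (pverts G) (pverts H) \<and>
         (\<forall>u \<in> pverts G. \<forall>v \<in> pverts G. (u, v) \<in> parcs G \<longleftrightarrow> (f u, f v) \<in> parcs H)"
    by blast
next
  assume "\<exists>f. bij_betw f (pverts G) (pverts H) \<and>
         (\<forall>u \<in> pverts G. \<forall>v \<in> pverts G. (u, v) \<in> parcs G \<longleftrightarrow> (f u, f v) \<in> parcs H)"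
  then obtain f where bij: "bij_betw f (pverts G) (pverts H)"
    and f: "\<And>u v. u \<in> pverts G \<Longrightarrow> v \<in> pverts G \<Longrightarrow> (u, v) \<in> parcs G \<longleftrightarrow> (f u, f v) \<in> parcs H"
    by blast
  note G1 = pair_wf_digraph.in_arcsD1[OF G] and G2 = pair_wf_digraph.in_arcsD2[OF G]
  note H1 = pair_wf_digraph.in_arcsD1[OF H] and H2 = pair_wf_digraph.in_arcsD2[OF H]
  define h where "h = \<lparr> iso_verts = f, iso_arcs = map_prod f f, iso_head = snd, iso_tail = fst \<rparr>"
  have inj: "inj_on f (pverts G)" and img: "f ` pverts G = pverts H"
    using bij by (auto simp: bij_betw_def)
  have "inj_on (map_prod f f) (parcs G)"
  proof (rule inj_on_subset)
    show "inj_on (map_prod f f) (pverts G \<times> pverts G)"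
      using inj by (rule map_prod_inj_on) (rule inj)
    show "parcs G \<subseteq> pverts G \<times> pverts G" by (auto dest: G1 G2)
  qed
  then have "pre_digraph.digraph_isomorphism (with_proj G) h"
    using G inj by (simp add: pre_digraph.digraph_isomorphism_def h_def wf_digraph_wp_iff)
  moreover have "map_prod f f ` parcs G = parcs H"
  proof (intro equalityI subsetI)
    fix e assume "e \<in> map_prod f f ` parcs G"
    then obtain u v where uv: "(u, v) \<in> parcs G" "e = (f u, f v)" by auto
    with f[OF G1[OF uv(1)] G2[OF uv(1)]] show "e \<in> parcs H" by simp
  next
    fix e assume "e \<in> parcs H"
    then obtain x y where e: "e = (x, y)" and xy: "(x, y) \<in> parcs H" by (cases e) simp
    have "x \<in> f ` pverts G" "y \<in> f ` pverts G" using H1[OF xy] H2[OF xy] img by simp_all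
    then obtain u v where uv: "u \<in> pverts G" "v \<in> pverts G" "x = f u" "y = f v" by blast
    then have "(u, v) \<in> parcs G" using f[OF uv(1,2)] xy by simp
    then have "map_prod f f (u, v) \<in> map_prod f f ` parcs G" by (rule imageI)
    then show "e \<in> map_prod f f ` parcs G" using e uv by simp
  qed
  then have "with_proj H = app_iso h (with_proj G)"
    using img by (simp add: app_iso_def h_def with_proj_def)
  ultimately show "graph_iso G H"
    by (auto simp: graph_iso_def digraph_iso_def)
qed

end

theory Submission
  imports Defs
begin

text \<open>
  The ideals of a product of \<open>n\<close> fields correspond to the subsets of the index set \<open>N\<close>, so
  the inclusion ideal graph is the comparability graph on the proper nonempty subsets of \<open>N\<close>.
  Comparable sets have distance 1, complementary sets distance 3, and all other pairs distance 2.
  Hence the pairs that are mutually maximally distant are the complementary ones and the incomparable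
  \<open>A\<close>, \<open>B\<close> with \<open>A \<inter> B \<noteq> {}\<close> and \<open>A \<union> B \<noteq> N\<close>. A singleton or its complement
  satisfies the second condition with no set, which leaves the \<open>n\<close> copies of \<open>K\<^sub>2\<close>. On the
  remaining sets, \<open>A \<subset> B\<close> are joined through \<open>{a, c}\<close> with \<open>a \<in> A\<close> and \<open>c \<notin> B\<close>,
  and every other nonadjacent pair reduces to this case on replacing \<open>A\<close> by its complement.
\<close>

subsection \<open>Ideals of a product of fields\<close>

text \<open>\<open>RDirProd_list\<close> nests binary products, so the operations on lists with a
  head are carried over from the binary product along \<open>RDirProd_list_hom1\<close>. Induction
  strips one factor for each step of the index.\<close>

lemma RDirProd_list_nth_hom:
  assumes "i < length Rs"
  shows "(\<lambda>xs. xs ! i) \<in> ring_hom (RDirProd_list Rs) (Rs ! i)"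
  using assms
proof (induction Rs arbitrary: i)
  case Nil
  then show ?case by simp
next
  case (Cons R Rs)
  note carr = RDirProd_list_carrier[of R Rs]
  have add: "(a # as) \<oplus>\<^bsub>RDirProd_list (R # Rs)\<^esub> (b # bs) =
      (a \<oplus>\<^bsub>R\<^esub> b) # (as \<oplus>\<^bsub>RDirProd_list Rs\<^esub> bs)"
    and mult: "(a # as) \<otimes>\<^bsub>RDirProd_list (R # Rs)\<^esub> (b # bs) =
      (a \<otimes>\<^bsub>R\<^esub> b) # (as \<otimes>\<^bsub>RDirProd_list Rs\<^esub> bs)"
    if "a \<in> carrier R" "b \<in> carrier R"
      "as \<in> carrier (RDirProd_list Rs)" "bs \<in> carrier (RDirProd_list Rs)" for a b as bs
    using ring_hom_add[OF RDirProd_list_hom1, of "(a, as)" R Rs "(b, bs)"]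
      ring_hom_mult[OF RDirProd_list_hom1, of "(a, as)" R Rs "(b, bs)"] that
    by (simp_all add: RDirProd_def DirProd_def monoid.defs)
  have one: "\<one>\<^bsub>RDirProd_list (R # Rs)\<^esub> = \<one>\<^bsub>R\<^esub> # \<one>\<^bsub>RDirProd_list Rs\<^esub>"
    by (simp add: RDirProd_list_one)
  show ?case
  proof (cases i)
    case 0
    then show ?thesis
      by (intro ring_hom_memI) (auto simp: carr add mult one)
  next
    case (Suc j)
    with Cons have "(\<lambda>xs. xs ! j) \<in> ring_hom (RDirProd_list Rs) (Rs ! j)" by simp
    from ring_hom_closed[OF this] ring_hom_add[OF this] ring_hom_mult[OF this] ring_hom_one[OF this] Suc
    show ?thesis
      by (intro ring_hom_memI) (auto simp: carr add mult one)
  qed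
qed

lemma RDirProd_list_zero_nth: "i < length Rs \<Longrightarrow> \<zero>\<^bsub>RDirProd_list Rs\<^esub> ! i = \<zero>\<^bsub>Rs ! i\<^esub>"
proof (induction Rs arbitrary: i)
  case (Cons R Rs)
  then show ?case by (cases i) (simp_all add: RDirProd_list_zero')
qed simp

text \<open>An encoding-free form of a finite product of fields: \<open>separate\<close> makes the
  coordinates jointly injective, and sums of the elements from \<open>interpolate\<close> make them
  jointly surjective.\<close>

locale field_coordinates = cring R for R :: "('a, 'r) ring_scheme" (structure) +
  fixes N :: "'i set" and F :: "'i \<Rightarrow> ('b, 's) ring_scheme" and c :: "'i \<Rightarrow> 'a \<Rightarrow> 'b"
  assumes finite_N: "finite N"
    and field_F: "i \<in> N \<Longrightarrow> field (F i)"
    and hom_c: "i \<in> N \<Longrightarrow> c i \<in> ring_hom R (F i)"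
    and interpolate: "i \<in> N \<Longrightarrow> a \<in> carrier (F i) \<Longrightarrow>
      \<exists>x\<in>carrier R. c i x = a \<and> (\<forall>j\<in>N - {i}. c j x = \<zero>\<^bsub>F j\<^esub>)"
    and separate: "x \<in> carrier R \<Longrightarrow> (\<And>i. i \<in> N \<Longrightarrow> c i x = \<zero>\<^bsub>F i\<^esub>) \<Longrightarrow> x = \<zero>"
begin

definition supported_ideal :: "'i set \<Rightarrow> 'a set" where
  "supported_ideal S = {x \<in> carrier R. \<forall>i\<in>N - S. c i x = \<zero>\<^bsub>F i\<^esub>}"

lemma ring_hom_ring_c: "i \<in> N \<Longrightarrow> ring_hom_ring R (F i) (c i)"
  using field_F[THEN field.is_ring] hom_c by (intro ring_hom_ringI2) (auto intro: ring_axioms)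

text \<open>An intersection of kernels of coordinate maps. Inserting \<open>carrier R\<close> keeps
  the family nonempty when no coordinate lies outside \<open>S\<close>.\<close>

lemma ideal_supported: "ideal (supported_ideal S) R"
proof -
  have "supported_ideal S =
      \<Inter>(insert (carrier R) ((\<lambda>i. a_kernel R (F i) (c i)) ` (N - S)))"
    by (auto simp: supported_ideal_def a_kernel_def')
  moreover have "ideal I R"
    if "I \<in> insert (carrier R) ((\<lambda>i. a_kernel R (F i) (c i)) ` (N - S))" for I
    using that ring_hom_ring_c by (auto intro: oneideal ring_hom_ring.kernel_is_ideal)
  ultimately show ?thesis
    using i_Intersect[of "insert (carrier R) ((\<lambda>i. a_kernel R (F i) (c i)) ` (N - S))"] by simp
qed

text \<open>A point \<open>i\<close> of \<open>S\<close> outside \<open>T\<close> is detected by an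
  element with coordinate one at \<open>i\<close> and zero elsewhere.\<close>

lemma supported_ideal_subset_iff:
  assumes "S \<subseteq> N"
  shows "supported_ideal S \<subseteq> supported_ideal T \<longleftrightarrow> S \<subseteq> T"
proof
  assume sub: "supported_ideal S \<subseteq> supported_ideal T"
  show "S \<subseteq> T"
  proof (rule subsetI, rule ccontr)
    fix i assume i: "i \<in> S" "i \<notin> T"
    with assms have "i \<in> N" by blast
    then interpret Fi: field "F i" by (rule field_F)
    from interpolate[OF \<open>i \<in> N\<close>, of "\<one>\<^bsub>F i\<^esub>"]
    obtain x where "x \<in> carrier R" "c i x = \<one>\<^bsub>F i\<^esub>" "\<forall>j\<in>N - {i}. c j x = \<zero>\<^bsub>F j\<^esub>"
      by auto
    then have "c i x \<noteq> \<zero>\<^bsub>F i\<^esub>" "x \<in> supported_ideal S"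
      using i by (auto simp: supported_ideal_def)
    moreover from this(1) have "x \<notin> supported_ideal T"
      using i \<open>i \<in> N\<close> by (auto simp: supported_ideal_def)
    ultimately show False using sub by blast
  qed
qed (auto simp: supported_ideal_def)

text \<open>Take for \<open>S\<close> the coordinates at which some element of \<open>I\<close> does
  not vanish. That elements supported on a finite \<open>T \<subseteq> S\<close> lie in
  \<open>I\<close> follows by induction on \<open>T\<close>: subtracting a suitable element of
  \<open>I\<close> clears one coordinate at a time.\<close>

lemma ideal_eq_supported:
  assumes "ideal I R"
  obtains S where "S \<subseteq> N" "I = supported_ideal S"
proof -
  interpret I: ideal I R by fact
  define S where "S = {i \<in> N. \<exists>x\<in>I. c i x \<noteq> \<zero>\<^bsub>F i\<^esub>}"
  have "supported_ideal T \<subseteq> I" if "finite T" "T \<subseteq> S" for T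
    using that
  proof (induction T)
    case empty
    have "supported_ideal {} \<subseteq> {\<zero>}" using separate by (auto simp: supported_ideal_def)
    then show ?case using I.zero_closed by auto
  next
    case (insert i T)
    from insert.prems obtain x where x: "i \<in> N" "x \<in> I" "c i x \<noteq> \<zero>\<^bsub>F i\<^esub>"
      by (auto simp: S_def)
    interpret Fi: field "F i" by (rule field_F[OF x(1)])
    have cx: "c i x \<in> Units (F i)"
      using x ring_hom_closed[OF hom_c[OF x(1)] I.Icarr] by (simp add: Fi.field_Units)
    show ?case
    proof
      fix y assume y: "y \<in> supported_ideal (insert i T)"
      then have yR: "y \<in> carrier R" by (simp add: supported_ideal_def)
      have cy: "c i y \<in> carrier (F i)" using ring_hom_closed[OF hom_c[OF x(1)] yR] .
      \<comment> \<open>With this choice \<open>x \<otimes> z\<close> agrees with \<open>y\<close>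
        at \<open>i\<close> and vanishes at all other coordinates, so
        \<open>y \<ominus> x \<otimes> z\<close> is supported on \<open>T\<close>.\<close>
      from interpolate[OF x(1), of "inv\<^bsub>F i\<^esub> (c i x) \<otimes>\<^bsub>F i\<^esub> c i y"] cx cy
      obtain z where z: "z \<in> carrier R" "c i z = inv\<^bsub>F i\<^esub> (c i x) \<otimes>\<^bsub>F i\<^esub> c i y"
        "\<forall>j\<in>N - {i}. c j z = \<zero>\<^bsub>F j\<^esub>" by auto
      have xR: "x \<in> carrier R" using x by (simp add: I.Icarr)
      have xz: "x \<otimes> z \<in> I" using x z by (simp add: I.I_r_closed)
      have "c j (y \<ominus> x \<otimes> z) = \<zero>\<^bsub>F j\<^esub>" if "j \<in> N - T" for j
      proof -
        from that interpret cj: ring_hom_ring R "F j" "c j" by (intro ring_hom_ring_c) simp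
        from that interpret Fj: field "F j" by (intro field_F) simp
        have diff: "c j (y \<ominus> x \<otimes> z) = c j y \<ominus>\<^bsub>F j\<^esub> c j x \<otimes>\<^bsub>F j\<^esub> c j z"
          using yR xR z(1) by (simp add: a_minus_def)
        show ?thesis
        proof (cases "j = i")
          case True
          have "c i x \<otimes>\<^bsub>F i\<^esub> (inv\<^bsub>F i\<^esub> (c i x) \<otimes>\<^bsub>F i\<^esub> c i y) = c i y"
            using cx cy by (simp add: Fi.m_assoc[symmetric] Fi.Units_closed)
          with True diff z(2) cy show ?thesis by (simp add: a_minus_def Fi.r_neg)
        next
          case False
          with y that have "c j y = \<zero>\<^bsub>F j\<^esub>" by (auto simp: supported_ideal_def)
          with False that diff z(3) xR show ?thesis by (simp add: a_minus_def)
        qed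
      qed
      then have "y \<ominus> x \<otimes> z \<in> supported_ideal T"
        using yR xR z(1) by (simp add: supported_ideal_def)
      then have "y \<ominus> x \<otimes> z \<in> I" using insert by auto
      then have "(y \<ominus> x \<otimes> z) \<oplus> x \<otimes> z \<in> I" using xz by (rule I.a_closed)
      also have "(y \<ominus> x \<otimes> z) \<oplus> x \<otimes> z = y" using yR xR z(1) by algebra
      finally show "y \<in> I" .
    qed
  qed
  moreover have "S \<subseteq> N" by (auto simp: S_def)
  moreover from this have "finite S" using finite_N by (rule finite_subset)
  moreover have "I \<subseteq> supported_ideal S" by (auto simp: supported_ideal_def S_def I.Icarr)
  ultimately have "I = supported_ideal S" by blast
  with \<open>S \<subseteq> N\<close> show ?thesis by (rule that)
qed

lemma supported_ideal_eq_iff: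
  "S \<subseteq> N \<Longrightarrow> T \<subseteq> N \<Longrightarrow> supported_ideal S = supported_ideal T \<longleftrightarrow> S = T"
  using supported_ideal_subset_iff by (metis subset_antisym order_refl)

lemma supported_ideal_empty: "supported_ideal {} = {\<zero>}"
proof -
  have "c i \<zero> = \<zero>\<^bsub>F i\<^esub>" if "i \<in> N" for i
    using ring_hom_zero[OF hom_c[OF that] ring_axioms] field_F[OF that, THEN field.is_ring] .
  then show ?thesis using separate by (auto simp: supported_ideal_def)
qed

lemma supported_ideal_N: "supported_ideal N = carrier R"
  by (auto simp: supported_ideal_def)

lemma bij_betw_supported_ideal:
  "bij_betw supported_ideal (Pow N - {{}, N}) (pverts (inclusion_ideal_graph R))"
proof -
  have "inj_on supported_ideal (Pow N)"
    by (auto simp: inj_on_def supported_ideal_eq_iff)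
  moreover have "supported_ideal ` Pow N = {I. ideal I R}"
    using ideal_supported by (auto elim: ideal_eq_supported)
  ultimately have "supported_ideal ` (Pow N - {{}, N}) = {I. ideal I R} - {{\<zero>}, carrier R}"
    using inj_on_image_set_diff[of supported_ideal "Pow N" "Pow N" "{{}, N}"]
    by (simp add: supported_ideal_empty supported_ideal_N)
  moreover have "inj_on supported_ideal (Pow N - {{}, N})"
    using \<open>inj_on supported_ideal (Pow N)\<close> by (rule inj_on_diff)
  moreover have "pverts (inclusion_ideal_graph R) = {I. ideal I R} - {{\<zero>}, carrier R}"
    by (auto simp: inclusion_ideal_graph_def Let_def)
  ultimately show ?thesis by (simp add: bij_betw_def)
qed

end

subsection \<open>Comparability graphs of subsets\<close>

text \<open>Powers of the arc relation are easier to compute with than walks. That \<open>u\<close>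
  is a vertex matters at \<open>k = 0\<close>: an empty walk must start at a vertex, while the
  identity relation has no such restriction.\<close>

lemma awalk_of_length_iff:
  assumes "pair_wf_digraph G" and "u \<in> pverts G"
  shows "(\<exists>p. pre_digraph.awalk (with_proj G) u p v \<and> length p = k) \<longleftrightarrow> (u, v) \<in> parcs G ^^ k"
  using assms(2)
proof (induction k arbitrary: u)
  case 0
  interpret pair_wf_digraph G by fact
  from 0 show ?case by (simp add: awalk_Nil_iff)
next
  case (Suc k)
  interpret pair_wf_digraph G by fact
  have "(\<exists>p. awalk u p v \<and> length p = Suc k) \<longleftrightarrow>
      (\<exists>w. (u, w) \<in> parcs G \<and> (\<exists>p. awalk w p v \<and> length p = k))"
  proof safe
    fix p assume "awalk u p v" "length p = Suc k"
    then show "\<exists>w. (u, w) \<in> parcs G \<and> (\<exists>p. awalk w p v \<and> length p = k)"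
      by (cases p) (auto 4 4 simp: awalk_Cons_iff)
  next
    fix w p assume "(u, w) \<in> parcs G" "awalk w p v"
    then show "\<exists>q. awalk u q v \<and> length q = Suc (length p)"
      by (intro exI[of _ "(u, w) # p"]) (simp add: awalk_Cons_iff)
  qed
  also have "\<dots> \<longleftrightarrow> (\<exists>w. (u, w) \<in> parcs G \<and> (w, v) \<in> parcs G ^^ k)"
    using Suc.IH in_arcsD2 by blast
  also have "\<dots> \<longleftrightarrow> (u, v) \<in> parcs G ^^ Suc k"
    by (meson relpow_Suc_D2 relpow_Suc_I2)
  finally show ?case .
qed

lemma graph_dist_eqI:
  assumes G: "pair_wf_digraph G" and u: "u \<in> pverts G"
    and walk: "(u, v) \<in> parcs G ^^ k"
    and min: "\<And>j. j < k \<Longrightarrow> (u, v) \<notin> parcs G ^^ j"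
  shows "graph_dist G u v = ereal (real k)"
  unfolding graph_dist_eq[OF G]
proof (rule INF_eqI)
  fix p assume "p \<in> {p. pre_digraph.awalk (with_proj G) u p v}"
  then have "(u, v) \<in> parcs G ^^ length p"
    using awalk_of_length_iff[OF G u] by blast
  then show "ereal (real k) \<le> ereal (real (length p))"
    using min by (metis ereal_less_eq(3) not_le of_nat_le_iff)
next
  obtain p where p: "pre_digraph.awalk (with_proj G) u p v" "length p = k"
    using awalk_of_length_iff[OF G u] walk by blast
  fix y assume "\<And>q. q \<in> {p. pre_digraph.awalk (with_proj G) u p v} \<Longrightarrow> y \<le> ereal (real (length q))"
  with p show "y \<le> ereal (real k)" by blast
qed

text \<open>Meant for a target \<open>H\<close> that is a disjoint union: a map out of
  \<open>H\<close> can be given by cases on the summands.\<close>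

lemma graph_iso_inverseI:
  assumes "pair_wf_digraph G" "pair_wf_digraph H" and g: "bij_betw g (pverts H) (pverts G)"
    and arcs: "\<And>x y. x \<in> pverts H \<Longrightarrow> y \<in> pverts H \<Longrightarrow> (g x, g y) \<in> parcs G \<longleftrightarrow> (x, y) \<in> parcs H"
  shows "graph_iso G H"
  unfolding graph_iso_iff[OF assms(1,2)]
proof (intro exI conjI ballI)
  let ?f = "inv_into (pverts H) g"
  show f: "bij_betw ?f (pverts G) (pverts H)" using g by (rule bij_betw_inv_into)
  fix u v assume "u \<in> pverts G" "v \<in> pverts G"
  then show "(u, v) \<in> parcs G \<longleftrightarrow> (?f u, ?f v) \<in> parcs H"
    using arcs[of "?f u" "?f v"] bij_betw_inv_into_right[OF g] bij_betwE[OF f] by simp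
qed

section \<open>Distances in the inclusion graph of subsets\<close>

text \<open>All that is kept of the ring: \<open>\<phi>\<close> names the vertices by proper
  nonempty subsets of \<open>N\<close>, with arcs given by proper inclusion.\<close>

locale subset_inclusion_graph =
  fixes N :: "'i set" and G :: "'v pair_pre_digraph" and \<phi> :: "'i set \<Rightarrow> 'v"
  assumes finite_N: "finite N" and card_N: "3 \<le> card N"
    and wf_G: "pair_wf_digraph G"
    and bij_\<phi>: "bij_betw \<phi> (Pow N - {{}, N}) (pverts G)"
    and arc_iff: "A \<in> Pow N - {{}, N} \<Longrightarrow> B \<in> Pow N - {{}, N} \<Longrightarrow>
      (\<phi> A, \<phi> B) \<in> parcs G \<longleftrightarrow> A \<subset> B \<or> B \<subset> A"
begin

abbreviation V where "V \<equiv> Pow N - {{}, N}"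

text \<open>Closed form of the distance. For subsets of \<open>N\<close> the value 3 occurs exactly
  at complementary pairs, apart from the comparable pair \<open>{}\<close>, \<open>N\<close>, which
  is not in \<open>V\<close>.\<close>

definition set_dist :: "'i set \<Rightarrow> 'i set \<Rightarrow> nat" where
  "set_dist A B = (if A = B then 0 else if A \<subset> B \<or> B \<subset> A then 1
     else if A \<inter> B \<noteq> {} \<or> A \<union> B \<noteq> N then 2 else 3)"

lemma \<phi>_in: "A \<in> V \<Longrightarrow> \<phi> A \<in> pverts G"
  using bij_\<phi> by (auto simp: bij_betw_def)

lemma \<phi>_eq_iff: "A \<in> V \<Longrightarrow> B \<in> V \<Longrightarrow> \<phi> A = \<phi> B \<longleftrightarrow> A = B"
  using inj_on_eq_iff[OF bij_betw_imp_inj_on[OF bij_\<phi>]] .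

lemma pverts_cases:
  assumes "u \<in> pverts G"
  obtains A where "A \<in> V" "u = \<phi> A"
  using assms bij_\<phi> by (auto simp: bij_betw_def)

lemma relpow_Suc_arcs:
  assumes "A \<in> V" "B \<in> V"
  shows "(\<phi> A, \<phi> B) \<in> parcs G ^^ Suc k \<longleftrightarrow>
    (\<exists>C\<in>V. (A \<subset> C \<or> C \<subset> A) \<and> (\<phi> C, \<phi> B) \<in> parcs G ^^ k)"
proof
  assume "(\<phi> A, \<phi> B) \<in> parcs G ^^ Suc k"
  then obtain w where w: "(\<phi> A, w) \<in> parcs G" "(w, \<phi> B) \<in> parcs G ^^ k"
    by (meson relpow_Suc_D2)
  then have "w \<in> pverts G" using pair_wf_digraph.in_arcsD2[OF wf_G] by blast
  then obtain C where "C \<in> V" "w = \<phi> C" by (rule pverts_cases)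
  moreover from this w arc_iff[OF assms(1)] have "A \<subset> C \<or> C \<subset> A" by simp
  ultimately show "\<exists>C\<in>V. (A \<subset> C \<or> C \<subset> A) \<and> (\<phi> C, \<phi> B) \<in> parcs G ^^ k" using w by blast
next
  assume "\<exists>C\<in>V. (A \<subset> C \<or> C \<subset> A) \<and> (\<phi> C, \<phi> B) \<in> parcs G ^^ k"
  then obtain C where C: "C \<in> V" "A \<subset> C \<or> C \<subset> A" "(\<phi> C, \<phi> B) \<in> parcs G ^^ k" by blast
  with arc_iff[OF assms(1)] have "(\<phi> A, \<phi> C) \<in> parcs G" by simp
  then show "(\<phi> A, \<phi> B) \<in> parcs G ^^ Suc k" using C(3) by (rule relpow_Suc_I2)
qed

lemma relpow_0_arcs: "A \<in> V \<Longrightarrow> B \<in> V \<Longrightarrow> (\<phi> A, \<phi> B) \<in> parcs G ^^ 0 \<longleftrightarrow> A = B"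
  by (simp add: \<phi>_eq_iff)

lemma relpow_1_arcs:
  assumes "A \<in> V" "B \<in> V"
  shows "(\<phi> A, \<phi> B) \<in> parcs G ^^ 1 \<longleftrightarrow> A \<subset> B \<or> B \<subset> A"
  using assms by (simp add: arc_iff)

text \<open>A common neighbour of incomparable sets cannot lie between them, so it lies below both
  or above both. It can then be replaced by \<open>A \<inter> B\<close> or
  \<open>A \<union> B\<close>, provided that this set is a vertex.\<close>

lemma relpow_2_arcs:
  assumes AB: "A \<in> V" "B \<in> V" and incomp: "\<not> A \<subseteq> B" "\<not> B \<subseteq> A"
  shows "(\<phi> A, \<phi> B) \<in> parcs G ^^ 2 \<longleftrightarrow> A \<inter> B \<noteq> {} \<or> A \<union> B \<noteq> N"
proof -
  have "(\<phi> A, \<phi> B) \<in> parcs G ^^ Suc 1 \<longleftrightarrow> (\<exists>C\<in>V. (A \<subset> C \<or> C \<subset> A) \<and> (C \<subset> B \<or> B \<subset> C))"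
    unfolding relpow_Suc_arcs[OF AB] using relpow_1_arcs[OF _ AB(2)] by (intro bex_cong refl) simp
  then have "(\<phi> A, \<phi> B) \<in> parcs G ^^ 2 \<longleftrightarrow> (\<exists>C\<in>V. (A \<subset> C \<or> C \<subset> A) \<and> (C \<subset> B \<or> B \<subset> C))"
    by (simp only: Suc_1)
  also have "\<dots> \<longleftrightarrow> A \<inter> B \<noteq> {} \<or> A \<union> B \<noteq> N"
  proof
    assume "\<exists>C\<in>V. (A \<subset> C \<or> C \<subset> A) \<and> (C \<subset> B \<or> B \<subset> C)"
    then obtain C where C: "C \<in> V" "A \<subset> C \<or> C \<subset> A" "C \<subset> B \<or> B \<subset> C" by (elim bexE conjE)
    then have "C \<subseteq> A \<inter> B \<or> A \<union> B \<subseteq> C" using incomp by (elim disjE) auto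
    with C(1) show "A \<inter> B \<noteq> {} \<or> A \<union> B \<noteq> N" by auto
  next
    assume "A \<inter> B \<noteq> {} \<or> A \<union> B \<noteq> N"
    then show "\<exists>C\<in>V. (A \<subset> C \<or> C \<subset> A) \<and> (C \<subset> B \<or> B \<subset> C)"
    proof
      assume "A \<inter> B \<noteq> {}"
      then show ?thesis using AB incomp by (intro bexI[of _ "A \<inter> B"]) auto
    next
      assume "A \<union> B \<noteq> N"
      then show ?thesis using AB incomp by (intro bexI[of _ "A \<union> B"]) auto
    qed
  qed
  finally show ?thesis .
qed

lemma card_ge_2_cases:
  assumes "A \<in> V"
  shows "2 \<le> card A \<or> 2 \<le> card (N - A)"
proof -
  have "card A + card (N - A) = card N"
    using assms finite_N card_mono[of N A] by (auto simp: card_Diff_subset finite_subset)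
  with card_N show ?thesis by linarith
qed

text \<open>Since \<open>N\<close> has at least three elements, \<open>A\<close> or its complement
  has two, and a walk of length 3 can be routed through a singleton on that side.\<close>

lemma relpow_3_complement:
  assumes A: "A \<in> V"
  shows "(\<phi> A, \<phi> (N - A)) \<in> parcs G ^^ 3"
proof -
  have AN: "N - A \<in> V" using A by auto
  have "\<exists>C\<in>V. \<exists>D\<in>V. (A \<subset> C \<or> C \<subset> A) \<and> (C \<subset> D \<or> D \<subset> C) \<and> (D \<subset> N - A \<or> N - A \<subset> D)"
    using card_ge_2_cases[OF A]
  proof
    assume "2 \<le> card A"
    then obtain x y where xy: "x \<in> A" "y \<in> A" "x \<noteq> y"
      using card_le_Suc0_iff_eq[OF finite_subset[OF _ finite_N], of A] A by fastforce
    from A have "N - A \<noteq> {}" by auto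
    \<comment> \<open>The walk goes from \<open>A\<close> down to \<open>{x}\<close>, up to
      \<open>insert x (N - A)\<close> and down to \<open>N - A\<close>. The point \<open>y\<close>
      makes the first inclusion proper and keeps the third set different from
      \<open>N\<close>.\<close>
    with xy A show ?thesis
      by (intro bexI[of _ "{x}"] bexI[of _ "insert x (N - A)"]) auto
  next
    assume "2 \<le> card (N - A)"
    then obtain x y where xy: "x \<in> N - A" "y \<in> N - A" "x \<noteq> y"
      using card_le_Suc0_iff_eq[of "N - A"] finite_N by auto
    \<comment> \<open>Here the walk goes up to \<open>insert x A\<close>, down to \<open>{x}\<close>
      and up to \<open>N - A\<close>; \<open>y\<close> again ensures properness.\<close>
    with A show ?thesis
      by (intro bexI[of _ "insert x A"] bexI[of _ "{x}"]) auto
  qed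
  then obtain C D where CD: "C \<in> V" "D \<in> V" "A \<subset> C \<or> C \<subset> A" "C \<subset> D \<or> D \<subset> C"
    "D \<subset> N - A \<or> N - A \<subset> D" by (elim bexE conjE)
  have "(\<phi> D, \<phi> (N - A)) \<in> parcs G ^^ 1"
    unfolding relpow_1_arcs[OF CD(2) AN] by (rule CD(5))
  then have "(\<phi> C, \<phi> (N - A)) \<in> parcs G ^^ Suc 1"
    unfolding relpow_Suc_arcs[OF CD(1) AN] by (intro bexI[OF _ CD(2)] conjI CD(4))
  then have "(\<phi> A, \<phi> (N - A)) \<in> parcs G ^^ Suc (Suc 1)"
    unfolding relpow_Suc_arcs[OF A AN] by (intro bexI[OF _ CD(1)] conjI CD(3))
  then show ?thesis by (simp add: numeral_3_eq_3)
qed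

lemma dist_eq_set_dist:
  assumes A: "A \<in> V" and B: "B \<in> V"
  shows "graph_dist G (\<phi> A) (\<phi> B) = ereal (real (set_dist A B))"
proof (rule graph_dist_eqI[OF wf_G \<phi>_in[OF A]])
  note simps = relpow_0_arcs[OF A B] relpow_1_arcs[OF A B]
  show "(\<phi> A, \<phi> B) \<in> parcs G ^^ set_dist A B"
  proof (cases "A \<subseteq> B \<or> B \<subseteq> A \<or> A \<inter> B \<noteq> {} \<or> A \<union> B \<noteq> N")
    case True
    then show ?thesis using simps relpow_2_arcs[OF A B] by (auto simp: set_dist_def psubset_eq)
  next
    case False
    then have "B = N - A" "set_dist A B = 3" using A B by (auto simp: set_dist_def)
    then show ?thesis using relpow_3_complement[OF A] by simp
  qed
  fix j assume "j < set_dist A B"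
  moreover from this have "j = 0 \<or> j = 1 \<or> j = 2" by (auto simp: set_dist_def split: if_splits)
  ultimately show "(\<phi> A, \<phi> B) \<notin> parcs G ^^ j"
    using simps relpow_2_arcs[OF A B] by (auto simp: set_dist_def psubset_eq split: if_splits)
qed

section \<open>Mutually maximally distant pairs of subsets\<close>

lemma mmd_iff_set_dist:
  assumes A: "A \<in> V" and B: "B \<in> V"
  shows "mutually_maximally_distant G (\<phi> A) (\<phi> B) \<longleftrightarrow> A \<noteq> B \<and>
    (\<forall>C\<in>V. A \<subset> C \<or> C \<subset> A \<longrightarrow> set_dist B C \<le> set_dist A B) \<and>
    (\<forall>C\<in>V. B \<subset> C \<or> C \<subset> B \<longrightarrow> set_dist A C \<le> set_dist A B)"
proof -
  have "(\<forall>w\<in>open_nbhd G (\<phi> X). graph_dist G (\<phi> Y) w \<le> graph_dist G (\<phi> A) (\<phi> B)) \<longleftrightarrow>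
      (\<forall>C\<in>V. X \<subset> C \<or> C \<subset> X \<longrightarrow> set_dist Y C \<le> set_dist A B)"
    if X: "X \<in> V" and Y: "Y \<in> V" for X Y
  proof -
    have "open_nbhd G (\<phi> X) = \<phi> ` {C \<in> V. X \<subset> C \<or> C \<subset> X}"
    proof (intro equalityI subsetI)
      fix w assume w: "w \<in> open_nbhd G (\<phi> X)"
      then have "w \<in> pverts G"
        using pair_wf_digraph.in_arcsD2[OF wf_G] by (auto simp: open_nbhd_def)
      then obtain C where "C \<in> V" "w = \<phi> C" by (rule pverts_cases)
      with w X show "w \<in> \<phi> ` {C \<in> V. X \<subset> C \<or> C \<subset> X}"
        using arc_iff[OF X] by (auto simp: open_nbhd_def)
    next
      fix w assume "w \<in> \<phi> ` {C \<in> V. X \<subset> C \<or> C \<subset> X}"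
      then show "w \<in> open_nbhd G (\<phi> X)" using arc_iff[OF X] by (auto simp: open_nbhd_def)
    qed
    then have "(\<forall>w\<in>open_nbhd G (\<phi> X). graph_dist G (\<phi> Y) w \<le> graph_dist G (\<phi> A) (\<phi> B)) \<longleftrightarrow>
        (\<forall>C\<in>{C \<in> V. X \<subset> C \<or> C \<subset> X}. graph_dist G (\<phi> Y) (\<phi> C) \<le> graph_dist G (\<phi> A) (\<phi> B))"
      by simp
    also have "\<dots> \<longleftrightarrow> (\<forall>C\<in>{C \<in> V. X \<subset> C \<or> C \<subset> X}. set_dist Y C \<le> set_dist A B)"
      using dist_eq_set_dist[OF Y] dist_eq_set_dist[OF A B] by (intro ball_cong refl) simp
    finally show ?thesis by blast
  qed
  from this[OF A B] this[OF B A] show ?thesis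
    using \<phi>_in A B \<phi>_eq_iff[OF A B] by (simp add: mutually_maximally_distant_def)
qed

text \<open>This excludes comparable pairs: adding to \<open>A\<close> a point outside
  \<open>B\<close> gives a neighbour of \<open>A\<close> at distance at least 2 from
  \<open>B\<close>, while \<open>A\<close> and \<open>B\<close> have distance 1.\<close>

lemma incomparable_superset:
  assumes A: "A \<in> V" and B: "B \<in> V" and sub: "A \<subset> B"
  shows "\<exists>C\<in>V. A \<subset> C \<and> \<not> C \<subseteq> B \<and> \<not> B \<subseteq> C"
proof -
  from B obtain y where "y \<in> N" "y \<notin> B" by auto
  moreover from sub obtain z where "z \<in> B" "z \<notin> A" by auto
  ultimately show ?thesis using A B sub by (intro bexI[of _ "insert y A"]) auto
qed

text \<open>The two alternatives are the pairs at distance 3 and those at distance 2. For subsets of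
  \<open>N\<close>, the second says that all four regions of the Venn diagram of \<open>A\<close>
  and \<open>B\<close> are nonempty.\<close>

definition resolving_adjacent :: "'i set \<Rightarrow> 'i set \<Rightarrow> bool" where
  "resolving_adjacent A B \<longleftrightarrow>
    B = N - A \<or> (\<not> A \<subseteq> B \<and> \<not> B \<subseteq> A \<and> A \<inter> B \<noteq> {} \<and> A \<union> B \<noteq> N)"

text \<open>Distance 3 is the maximum, so complements qualify. An incomparable pair at distance 2
  fails exactly when a neighbour of one set is the complement of the other.\<close>

lemma mmd_iff:
  assumes A: "A \<in> V" and B: "B \<in> V"
  shows "mutually_maximally_distant G (\<phi> A) (\<phi> B) \<longleftrightarrow> resolving_adjacent A B"
proof -
  have le3: "set_dist X Y \<le> 3" for X Y by (simp add: set_dist_def)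
  consider "A \<subset> B \<or> B \<subset> A" | "A = B" | "B = N - A"
    | "\<not> A \<subseteq> B" "\<not> B \<subseteq> A" "B \<noteq> N - A" by blast
  then show ?thesis
  proof cases
    case 1
    then have "set_dist A B = 1" by (auto simp: set_dist_def)
    moreover from 1 have "(\<exists>C\<in>V. A \<subset> C \<and> \<not> C \<subseteq> B \<and> \<not> B \<subseteq> C) \<or>
        (\<exists>C\<in>V. B \<subset> C \<and> \<not> C \<subseteq> A \<and> \<not> A \<subseteq> C)"
      using incomparable_superset[OF A B] incomparable_superset[OF B A] by (elim disjE) simp_all
    moreover have "\<not> set_dist X C \<le> 1" if "\<not> C \<subseteq> X" "\<not> X \<subseteq> C" for X C
      using that by (auto simp: set_dist_def)
    ultimately have "\<not> mutually_maximally_distant G (\<phi> A) (\<phi> B)"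
      unfolding mmd_iff_set_dist[OF A B] by metis
    moreover from 1 A B have "B \<noteq> N - A" by auto
    ultimately show ?thesis using 1 by (auto simp: resolving_adjacent_def)
  next
    case 2
    with A have "B \<noteq> N - A" by auto
    with 2 show ?thesis by (simp add: mutually_maximally_distant_def resolving_adjacent_def)
  next
    case 3
    with A B have "set_dist A B = 3" "A \<noteq> B" by (auto simp: set_dist_def)
    then have "mutually_maximally_distant G (\<phi> A) (\<phi> B)"
      unfolding mmd_iff_set_dist[OF A B] using le3 by simp
    with 3 show ?thesis by (simp add: resolving_adjacent_def)
  next
    case 4
    have dist3: "set_dist X C \<le> 2 \<longleftrightarrow> C \<noteq> N - X" if "X \<in> V" "C \<in> V" for X C
      using that by (auto simp: set_dist_def)
    from 4 A B have "set_dist A B = 2" "A \<noteq> B" by (auto simp: set_dist_def)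
    then have "mutually_maximally_distant G (\<phi> A) (\<phi> B) \<longleftrightarrow>
        (\<forall>C\<in>V. A \<subset> C \<or> C \<subset> A \<longrightarrow> C \<noteq> N - B) \<and> (\<forall>C\<in>V. B \<subset> C \<or> C \<subset> B \<longrightarrow> C \<noteq> N - A)"
      unfolding mmd_iff_set_dist[OF A B] using dist3 A B by simp
    also have "\<dots> \<longleftrightarrow> \<not> (A \<subset> N - B \<or> N - B \<subset> A) \<and> \<not> (B \<subset> N - A \<or> N - A \<subset> B)"
      using A B by blast
    \<comment> \<open>\<open>A \<subset> N - B\<close> expresses disjointness and
      \<open>N - B \<subset> A\<close> that the two sets cover \<open>N\<close>, as equality is
      excluded in this case. The second conjunct is the same condition after taking
      complements.\<close>
    also have "\<dots> \<longleftrightarrow> A \<inter> B \<noteq> {} \<and> A \<union> B \<noteq> N"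
      using 4 A B by blast
    finally show ?thesis using 4 by (simp add: resolving_adjacent_def)
  qed
qed

lemma resolving_adjacent_sym:
  assumes "A \<subseteq> N" "B \<subseteq> N"
  shows "resolving_adjacent A B \<longleftrightarrow> resolving_adjacent B A"
proof -
  have "B = N - A \<longleftrightarrow> A = N - B" using assms by blast
  then show ?thesis unfolding resolving_adjacent_def by (simp only: Int_commute Un_commute) blast
qed

section \<open>The connected summand \<open>H\<close>\<close>

text \<open>The subsets with at least two elements inside and at least two outside, phrased so that
  witnesses are at hand. For \<open>card N = 3\<close> there are none, and \<open>H\<close> is the
  empty graph.\<close>

definition middle_sets :: "'i set set" where
  "middle_sets = {A. A \<subseteq> N \<and> (\<exists>x\<in>A. \<exists>y\<in>A. x \<noteq> y) \<and> (\<exists>x\<in>N - A. \<exists>y\<in>N - A. x \<noteq> y)}"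

lemma middle_sets_subset: "middle_sets \<subseteq> V"
  by (auto simp: middle_sets_def)

lemma complement_middle: "A \<in> middle_sets \<Longrightarrow> N - A \<in> middle_sets"
  by (auto simp: middle_sets_def double_diff)

text \<open>A singleton is contained in \<open>B\<close> or disjoint from it; dually,
  \<open>N - {i}\<close> contains \<open>B\<close> or covers \<open>N\<close> together with it. Only
  the complement remains as a neighbour.\<close>

lemma resolving_adjacent_singleton:
  assumes "i \<in> N" "B \<in> V"
  shows "resolving_adjacent {i} B \<longleftrightarrow> B = N - {i}"
    and "resolving_adjacent (N - {i}) B \<longleftrightarrow> B = {i}"
proof -
  show "resolving_adjacent {i} B \<longleftrightarrow> B = N - {i}"
    by (auto simp: resolving_adjacent_def)
  have "B \<subseteq> N - {i} \<or> (N - {i}) \<union> B = N" "N - (N - {i}) = {i}" using assms by auto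
  then show "resolving_adjacent (N - {i}) B \<longleftrightarrow> B = {i}"
    unfolding resolving_adjacent_def by metis
qed

text \<open>This is \<open>H\<close>, the subgraph of the strong resolving graph induced on the
  middle sets.\<close>

definition middle_graph :: "'v pair_pre_digraph" where
  "middle_graph = \<lparr> pverts = \<phi> ` middle_sets,
     parcs = {(u, v). u \<in> \<phi> ` middle_sets \<and> v \<in> \<phi> ` middle_sets \<and>
       mutually_maximally_distant G u v} \<rparr>"

text \<open>Swapping \<open>u\<close> and \<open>v\<close> also turns the bound into
  \<open>graph_dist G v u\<close>. Passing through the symmetric relation
  \<open>resolving_adjacent\<close> avoids a separate proof that the distance is symmetric.\<close>

lemma mutually_maximally_distant_sym:
  "mutually_maximally_distant G u v \<Longrightarrow> mutually_maximally_distant G v u"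
proof -
  assume uv: "mutually_maximally_distant G u v"
  then obtain A B where "A \<in> V" "u = \<phi> A" "B \<in> V" "v = \<phi> B"
    by (metis mutually_maximally_distant_verts pverts_cases)
  with uv show ?thesis using resolving_adjacent_sym[of A B] by (simp add: mmd_iff)
qed

lemma pair_bidirected_middle_graph: "pair_bidirected_digraph middle_graph"
proof unfold_locales
  show "symmetric (with_proj middle_graph)"
    using mutually_maximally_distant_sym by (auto simp: middle_graph_def symmetric_def intro!: symI)
qed (auto simp: middle_graph_def dest: mutually_maximally_distant_verts)

text \<open>Both sets contain \<open>a\<close>, \<open>a'\<close> and miss \<open>c\<close>,
  \<open>c'\<close>. Hence \<open>C = {a, c}\<close> meets each of them in \<open>a\<close>, leaves
  \<open>a'\<close> uncovered, sticks out by \<open>c\<close>, and misses \<open>c'\<close> together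
  with them.\<close>

lemma middle_sets_path:
  assumes A: "A \<in> middle_sets" and B: "B \<in> middle_sets" and "A \<subset> B"
  obtains C where "C \<in> middle_sets" "resolving_adjacent A C" "resolving_adjacent C B"
proof -
  from A obtain a a' where a: "a \<in> A" "a' \<in> A" "a \<noteq> a'" by (auto simp: middle_sets_def)
  from B obtain c c' where c: "c \<in> N - B" "c' \<in> N - B" "c \<noteq> c'" by (auto simp: middle_sets_def)
  have sub: "A \<subseteq> N" "B \<subseteq> N" using A B by (auto simp: middle_sets_def)
  have ne: "a \<noteq> c" using a c \<open>A \<subset> B\<close> by auto
  have "{a, c} \<in> middle_sets"
  proof -
    have "a' \<in> N - {a, c}" "c' \<in> N - {a, c}" "a' \<noteq> c'" using a c sub \<open>A \<subset> B\<close> by auto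
    then show ?thesis using ne a c sub unfolding middle_sets_def by blast
  qed
  moreover have "resolving_adjacent A {a, c}"
    using a c sub \<open>A \<subset> B\<close> by (auto simp: resolving_adjacent_def)
  moreover have "resolving_adjacent {a, c} B"
    using a c sub \<open>A \<subset> B\<close> by (auto simp: resolving_adjacent_def)
  ultimately show ?thesis by (rule that)
qed

lemma connected_middle_graph: "connected_simple_graph middle_graph"
proof -
  define linked where
    \<comment> \<open>Reachability in the form that \<open>connected_conv\<close> uses, pulled back
      to sets.\<close>
    "linked A B \<longleftrightarrow> (\<phi> A, \<phi> B) \<in> rtrancl_on (pverts middle_graph) ((parcs middle_graph)\<^sup>s)" for A B
  have arc: "linked A B"
    if "A \<in> middle_sets" "B \<in> middle_sets" "resolving_adjacent A B" for A B
  proof -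
    have "(\<phi> A, \<phi> B) \<in> (parcs middle_graph)\<^sup>s"
      using that mmd_iff[of A B] middle_sets_subset by (auto simp: middle_graph_def symcl_def)
    then show ?thesis
      using that unfolding linked_def
      by (intro rtrancl_on_into_rtrancl_on[OF rtrancl_on_refl]) (auto simp: middle_graph_def)
  qed
  have trans: "linked A C" if "linked A B" "linked B C" for A B C
    using that unfolding linked_def by (rule rtrancl_on_trans)
  have sub: "linked A B \<and> linked B A"
    if AB: "A \<in> middle_sets" "B \<in> middle_sets" "A \<subset> B" for A B
  proof -
    obtain C where C: "C \<in> middle_sets" "resolving_adjacent A C" "resolving_adjacent C B"
      using middle_sets_path[OF AB] .
    moreover have "A \<subseteq> N" "B \<subseteq> N" "C \<subseteq> N" using AB C by (auto simp: middle_sets_def)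
    ultimately have "resolving_adjacent C A" "resolving_adjacent B C"
      using resolving_adjacent_sym by blast+
    with C AB show ?thesis by (meson arc trans)
  qed
  have comparable: "linked A B"
    if "A \<in> middle_sets" "B \<in> middle_sets" "A \<subseteq> B \<or> B \<subseteq> A" for A B
  proof (cases "A = B")
    case True
    with that show ?thesis by (simp add: linked_def middle_graph_def)
  next
    case False
    with that sub show ?thesis by blast
  qed
  have "linked A B" if A: "A \<in> middle_sets" and B: "B \<in> middle_sets" for A B
  proof (cases "A \<subseteq> B \<or> B \<subseteq> A \<or> resolving_adjacent A B")
    case True
    with A B comparable arc show ?thesis by blast
  next
    case False
    have "A \<subseteq> N" "B \<subseteq> N" using A B by (auto simp: middle_sets_def)
    \<comment> \<open>Incomparable sets that are not adjacent are disjoint or cover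
      \<open>N\<close>, which is comparability of \<open>N - A\<close> with
      \<open>B\<close>.\<close>
    with False have "N - A \<subseteq> B \<or> B \<subseteq> N - A" by (auto simp: resolving_adjacent_def)
    then have "linked (N - A) B" using A B comparable complement_middle by blast
    moreover have "linked A (N - A)"
      using A complement_middle by (intro arc) (auto simp: resolving_adjacent_def)
    ultimately show ?thesis using trans by blast
  qed
  then have "pverts middle_graph = {} \<or> connected (with_proj middle_graph)"
    unfolding linked_def connected_conv by (auto simp: middle_graph_def)
  with pair_bidirected_middle_graph show ?thesis by (simp add: connected_simple_graph_def)
qed

section \<open>Splitting off the copies of \<open>K_2\<close>\<close>

text \<open>Every vertex has its complement as a partner.\<close>

lemma strong_resolving_verts: "pverts (strong_resolving_graph G) = pverts G"
proof -
  have "\<exists>v\<in>pverts G. mutually_maximally_distant G u v" if u: "u \<in> pverts G" for u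
  proof -
    from u obtain A where A: "A \<in> V" "u = \<phi> A" by (rule pverts_cases)
    moreover from A have "N - A \<in> V" by auto
    ultimately show ?thesis
      using mmd_iff[of A "N - A"] \<phi>_in by (auto simp: resolving_adjacent_def)
  qed
  then show ?thesis by (auto simp: strong_resolving_graph_def)
qed

text \<open>Indexed like the vertices of \<open>graph_copies n (complete_graph 2)\<close>:
  \<open>k\<close> selects the copy and \<open>b\<close> the vertex in it.\<close>

definition extreme_set :: "(nat \<Rightarrow> 'i) \<Rightarrow> nat \<times> nat \<Rightarrow> 'i set" where
  "extreme_set e = (\<lambda>(k, b). if b = 0 then {e k} else N - {e k})"

lemma bij_betw_extreme_set:
  assumes e: "bij_betw e {..<n} N"
  shows "bij_betw (extreme_set e) ({..<n} \<times> {..<2}) (V - middle_sets)"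
proof -
  have eN: "e k \<in> N" if "k < n" for k using e that by (auto simp: bij_betw_def)
  have e_eq: "e k = e l \<longleftrightarrow> k = l" if "k < n" "l < n" for k l
    using inj_on_eq_iff[OF bij_betw_imp_inj_on[OF e]] that by simp
  \<comment> \<open>The bound \<open>3 \<le> card N\<close> keeps singletons distinct from
    complements of singletons.\<close>
  have not2: "N \<noteq> {x, y}" for x y
    using card_N card_insert_le_m1[of 2 "{y}" x] by auto
  have ne: "{x} \<noteq> N - {y}" if "x \<in> N" "y \<in> N" for x y
    using not2[of x y] that by blast
  have inj: "inj_on (extreme_set e) ({..<n} \<times> {..<2})"
  proof (rule inj_onI)
    fix p q assume "p \<in> {..<n} \<times> {..<2::nat}" "q \<in> {..<n} \<times> {..<2::nat}"
      and eq: "extreme_set e p = extreme_set e q"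
    then obtain k b l c where p: "p = (k, b)" "q = (l, c)" "k < n" "l < n" "b < 2" "c < 2" by auto
    have kN: "e k \<in> N" "e l \<in> N" using p eN by simp_all
    have "b = 0 \<longleftrightarrow> c = 0"
      using eq ne[OF kN] ne[OF kN(2,1)] by (auto simp: p extreme_set_def split: if_splits)
    moreover from this have "e k = e l"
      using eq kN by (auto simp: p extreme_set_def split: if_splits)
    ultimately show "p = q" using p e_eq[OF p(3,4)] by auto
  qed
  have sub: "extreme_set e p \<in> V - middle_sets" if p: "p \<in> {..<n} \<times> {..<2}" for p
  proof -
    obtain k b where k: "p = (k, b)" "k < n" using p by auto
    have "{e k} \<in> V - middle_sets" "N - {e k} \<in> V - middle_sets"
      using eN[OF k(2)] not2[of "e k" "e k"] by (auto simp: middle_sets_def)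
    with k show ?thesis by (simp add: extreme_set_def)
  qed
  have "V - middle_sets \<subseteq> extreme_set e ` ({..<n} \<times> {..<2})"
  proof
    fix A assume A: "A \<in> V - middle_sets"
    then have "(\<exists>i\<in>N. A = {i}) \<or> (\<exists>i\<in>N. A = N - {i})"
      unfolding middle_sets_def by blast
    then obtain i where i: "i \<in> N" "A = {i} \<or> A = N - {i}" by blast
    moreover obtain k where "k < n" "i = e k" using e i(1) by (auto simp: bij_betw_def)
    ultimately have "A = extreme_set e (k, 0) \<or> A = extreme_set e (k, 1)"
      by (auto simp: extreme_set_def)
    with \<open>k < n\<close> show "A \<in> extreme_set e ` ({..<n} \<times> {..<2})" by force
  qed
  with inj sub show ?thesis by (auto simp: bij_betw_def)
qed

text \<open>For \<open>b < 2\<close>, \<open>1 - b\<close> exchanges 0 and 1, so it passes to the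
  other vertex of the same copy.\<close>

lemma resolving_adjacent_extreme_set:
  assumes e: "bij_betw e {..<n} N" and kb: "k < n" "b < 2" and B: "B \<in> V"
  shows "resolving_adjacent (extreme_set e (k, b)) B \<longleftrightarrow> B = extreme_set e (k, 1 - b)"
proof -
  have "e k \<in> N" using e kb by (auto simp: bij_betw_def)
  from resolving_adjacent_singleton[OF this B] kb show ?thesis by (auto simp: extreme_set_def)
qed

lemma pair_wf_strong_resolving: "pair_wf_digraph (strong_resolving_graph G)"
proof -
  have "parcs (strong_resolving_graph G) \<subseteq> pverts G \<times> pverts G"
    by (auto simp: strong_resolving_graph_def dest: mutually_maximally_distant_verts)
  then show ?thesis by unfold_locales (auto simp: strong_resolving_verts)
qed

text \<open>The map is the identity on \<open>H\<close> and names the vertices of the copies by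
  extreme sets. No arc joins the summands, because the only neighbour of an extreme set is its
  complement, which is extreme too.\<close>

lemma strong_resolving_graph_iso:
  "graph_iso (strong_resolving_graph G)
    (graph_sum middle_graph (graph_copies (card N) (complete_graph 2)))"
proof -
  obtain e where e: "bij_betw e {..<card N} N"
    using ex_bij_betw_nat_finite[OF finite_N] by (auto simp: atLeast0LessThan)
  let ?K = "graph_copies (card N) (complete_graph 2)"
  let ?E = "extreme_set e"
  let ?g = "case_sum id (\<phi> \<circ> ?E)"
  have vertsK: "pverts ?K = {..<card N} \<times> {..<2}"
    by (simp add: graph_copies_def complete_graph_def)
  have bijE: "bij_betw ?E (pverts ?K) (V - middle_sets)"
    unfolding vertsK by (rule bij_betw_extreme_set[OF e])
  have inE: "?E p \<in> V - middle_sets" if "p \<in> pverts ?K" for p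
    using bij_betwE[OF bijE] that by blast
  have inj\<phi>: "inj_on \<phi> V" and img\<phi>: "\<phi> ` V = pverts G"
    using bij_\<phi> by (simp_all add: bij_betw_def)
  have bij: "bij_betw ?g (pverts middle_graph <+> pverts ?K) (pverts G)"
  proof -
    have bij2: "bij_betw (\<phi> \<circ> ?E) (pverts ?K) (\<phi> ` (V - middle_sets))"
      using bijE by (rule bij_betw_trans) (meson Diff_subset inj\<phi> bij_betw_imageI inj_on_subset)
    have disj: "\<phi> ` middle_sets \<inter> \<phi> ` (V - middle_sets) = {}"
      using inj_on_image_Int[OF inj\<phi> middle_sets_subset, of "V - middle_sets"] by auto
    have "inj_on ?g (pverts middle_graph <+> pverts ?K)"
    proof (rule inj_onI)
      fix x y assume xy: "x \<in> pverts middle_graph <+> pverts ?K" "y \<in> pverts middle_graph <+> pverts ?K"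
        "?g x = ?g y"
      have m: "?g (Inl u) \<in> \<phi> ` middle_sets" if "Inl u \<in> pverts middle_graph <+> pverts ?K" for u
        using that by (auto simp: middle_graph_def)
      have k: "?g (Inr p) \<in> \<phi> ` (V - middle_sets)" if "Inr p \<in> pverts middle_graph <+> pverts ?K" for p
        using that inE by auto
      show "x = y"
      proof (cases x; cases y)
        fix u v assume "x = Inl u" "y = Inl v"
        with xy(3) show ?thesis by simp
      next
        fix p q assume "x = Inr p" "y = Inr q"
        with xy inj_onD[OF bij_betw_imp_inj_on[OF bij2], of p q] show ?thesis by auto
      next
        fix u p assume "x = Inl u" "y = Inr p"
        with xy m[of u] k[of p] disj show ?thesis by auto
      next
        fix u p assume "x = Inr p" "y = Inl u"
        with xy m[of u] k[of p] disj show ?thesis by auto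
      qed
    qed
    moreover have "?g ` (pverts middle_graph <+> pverts ?K) = \<phi> ` middle_sets \<union> \<phi> ` (V - middle_sets)"
      using bij_betw_imp_surj_on[OF bij2] by (simp add: Plus_def image_Un image_image middle_graph_def)
    moreover have "\<phi> ` middle_sets \<union> \<phi> ` (V - middle_sets) = pverts G"
      using middle_sets_subset img\<phi> by (simp add: image_Un[symmetric] Un_absorb1)
    ultimately show ?thesis by (simp add: bij_betw_def)
  qed
  have wf: "pair_wf_digraph (graph_sum middle_graph ?K)"
    by unfold_locales (auto simp: graph_sum_def middle_graph_def graph_copies_def complete_graph_def)
  have arcK: "mutually_maximally_distant G (\<phi> (?E p)) (\<phi> B) \<longleftrightarrow>
      B = ?E (fst p, 1 - snd p)" if "p \<in> pverts ?K" "B \<in> V" for p B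
    using that resolving_adjacent_extreme_set[OF e, of "fst p" "snd p" B] mmd_iff[of "?E p" B] inE[of p]
    by (auto simp: vertsK)
  have flip: "(fst p, 1 - snd p) \<in> pverts ?K" if "p \<in> pverts ?K" for p
    using that by (auto simp: vertsK)
  have mixed: "\<not> mutually_maximally_distant G (\<phi> (?E p)) u"
    if "p \<in> pverts ?K" "u \<in> pverts middle_graph" for p u
  proof -
    from that(2) obtain B where B: "B \<in> middle_sets" "u = \<phi> B" by (auto simp: middle_graph_def)
    with arcK[OF that(1), of B] middle_sets_subset inE[OF flip[OF that(1)]] show ?thesis by auto
  qed
  have arcs: "(?g x, ?g y) \<in> parcs (strong_resolving_graph G) \<longleftrightarrow>
      (x, y) \<in> parcs (graph_sum middle_graph ?K)"
    if xy: "x \<in> pverts middle_graph <+> pverts ?K" "y \<in> pverts middle_graph <+> pverts ?K" for x y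
  proof (cases x; cases y)
    fix u v assume "x = Inl u" "y = Inl v"
    with xy show ?thesis by (auto simp: strong_resolving_graph_def graph_sum_def middle_graph_def)
  next
    fix p q assume pq: "x = Inr p" "y = Inr q"
    then have pqK: "p \<in> pverts ?K" "q \<in> pverts ?K" using xy by auto
    have "(?g x, ?g y) \<in> parcs (strong_resolving_graph G) \<longleftrightarrow> ?E q = ?E (fst p, 1 - snd p)"
      using arcK[OF pqK(1), of "?E q"] inE[OF pqK(2)] pq by (simp add: strong_resolving_graph_def)
    also have "\<dots> \<longleftrightarrow> q = (fst p, 1 - snd p)"
      using inj_on_eq_iff[OF bij_betw_imp_inj_on[OF bijE] pqK(2) flip[OF pqK(1)]] .
    \<comment> \<open>Within a copy the vertices are 0 and 1, so differing from \<open>snd p\<close>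
      means being \<open>1 - snd p\<close>.\<close>
    also have "\<dots> \<longleftrightarrow> (p, q) \<in> parcs ?K"
      using pqK by (auto simp: graph_copies_def complete_graph_def prod_eq_iff) arith
    also have "\<dots> \<longleftrightarrow> (x, y) \<in> parcs (graph_sum middle_graph ?K)"
      using pq by (auto simp: graph_sum_def)
    finally show ?thesis .
  next
    fix u p assume "x = Inl u" "y = Inr p"
    with xy mixed[of p u] mutually_maximally_distant_sym show ?thesis
      by (auto simp: strong_resolving_graph_def graph_sum_def)
  next
    fix u p assume "x = Inr p" "y = Inl u"
    with xy mixed[of p u] show ?thesis
      by (auto simp: strong_resolving_graph_def graph_sum_def)
  qed
  show ?thesis
  proof (rule graph_iso_inverseI[OF pair_wf_strong_resolving wf])
    show "bij_betw ?g (pverts (graph_sum middle_graph ?K)) (pverts (strong_resolving_graph G))"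
      using bij by (simp add: graph_sum_def strong_resolving_verts)
    show "(?g x, ?g y) \<in> parcs (strong_resolving_graph G) \<longleftrightarrow> (x, y) \<in> parcs (graph_sum middle_graph ?K)"
      if "x \<in> pverts (graph_sum middle_graph ?K)" "y \<in> pverts (graph_sum middle_graph ?K)" for x y
      using arcs that by (simp add: graph_sum_def)
  qed
qed


end

theorem lemma2p5:
  fixes R :: "('a, 'r) ring_scheme"
    and Fs :: "('b, 's) ring_scheme list"
    and n :: nat
  assumes "n \<ge> 3"
    and "cring R"
    and "length Fs = n"
    and "\<And>i. i < n \<Longrightarrow> field (Fs ! i)"
    and "R \<simeq> RDirProd_list Fs"
  shows "\<exists>H :: 'a set pair_pre_digraph.
           connected_simple_graph H \<and>
           graph_iso (strong_resolving_graph (inclusion_ideal_graph R))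
             (graph_sum H (graph_copies n (complete_graph 2)))"
proof -
  interpret R: cring R by fact
  obtain h where h: "h \<in> ring_iso R (RDirProd_list Fs)"
    using \<open>R \<simeq> RDirProd_list Fs\<close> by (auto simp: is_ring_iso_def)
  have ring_F: "ring (Fs ! i)" if "i < length Fs" for i
    using assms that by (simp add: field.is_ring)
  have ring_P: "ring (RDirProd_list Fs)" using ring_F by (rule RDirProd_list_is_ring)
  have hom: "h \<in> ring_hom R (RDirProd_list Fs)" and bij: "bij_betw h (carrier R) (carrier (RDirProd_list Fs))"
    using h by (auto simp: ring_iso_def)
  interpret field_coordinates R "{..<n}" "\<lambda>i. Fs ! i" "\<lambda>i x. h x ! i"
  proof (intro field_coordinates.intro field_coordinates_axioms.intro)
    show "field (Fs ! i)" if "i \<in> {..<n}" for i using that assms by simp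
    show "(\<lambda>x. h x ! i) \<in> ring_hom R (Fs ! i)" if "i \<in> {..<n}" for i
      using ring_hom_trans[OF hom RDirProd_list_nth_hom[of i Fs]] that assms by (simp add: comp_def)
    show "\<exists>x\<in>carrier R. h x ! i = a \<and> (\<forall>j\<in>{..<n} - {i}. h x ! j = \<zero>\<^bsub>Fs ! j\<^esub>)"
      if i: "i \<in> {..<n}" and a: "a \<in> carrier (Fs ! i)" for i a
    proof -
      let ?z = "\<zero>\<^bsub>RDirProd_list Fs\<^esub>"
      have z: "?z \<in> carrier (RDirProd_list Fs)" using ring_P by (rule ring.ring_simprules(2))
      \<comment> \<open>The interpolating element is the preimage under \<open>h\<close> of the zero
        list with \<open>a\<close> put at position \<open>i\<close>.\<close>
      have "?z[i := a] \<in> carrier (RDirProd_list Fs)"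
        using RDirProd_list_carrier_mem[OF z] a i assms(3)
        by (intro RDirProd_list_carrier_memI) (auto simp: nth_list_update)
      then obtain x where "x \<in> carrier R" "h x = ?z[i := a]"
        using bij by (metis bij_betw_imp_surj_on imageE)
      then show ?thesis
        using i assms RDirProd_list_carrier_mem(1)[OF z] RDirProd_list_zero_nth[of _ Fs]
        by (intro bexI[of _ x]) auto
    qed
    show "x = \<zero>\<^bsub>R\<^esub>" if x: "x \<in> carrier R" and zero: "\<And>i. i \<in> {..<n} \<Longrightarrow> h x ! i = \<zero>\<^bsub>Fs ! i\<^esub>" for x
    proof -
      have "\<zero>\<^bsub>RDirProd_list Fs\<^esub> \<in> carrier (RDirProd_list Fs)"
        using ring_P by (rule ring.ring_simprules(2))
      moreover have "h x \<in> carrier (RDirProd_list Fs)" using hom x by (rule ring_hom_closed)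
      ultimately have "h x = \<zero>\<^bsub>RDirProd_list Fs\<^esub>"
        using zero RDirProd_list_carrier_mem(1) assms(3) RDirProd_list_zero_nth[of _ Fs]
        by (intro nth_equalityI) (auto simp: RDirProd_list_carrier_mem(1))
      also have "\<dots> = h \<zero>\<^bsub>R\<^esub>" using ring_hom_zero[OF hom R.ring_axioms ring_P] by simp
      finally show ?thesis
        using inj_onD[OF bij_betw_imp_inj_on[OF bij]] x by simp
    qed
  qed (simp_all add: assms)
  interpret subset_inclusion_graph "{..<n}" "inclusion_ideal_graph R" supported_ideal
  proof (rule subset_inclusion_graph.intro)
    show "(supported_ideal A, supported_ideal B) \<in> parcs (inclusion_ideal_graph R) \<longleftrightarrow> A \<subset> B \<or> B \<subset> A"
      if "A \<in> Pow {..<n} - {{}, {..<n}}" "B \<in> Pow {..<n} - {{}, {..<n}}" for A B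
    proof -
      have "supported_ideal A \<in> pverts (inclusion_ideal_graph R)"
        "supported_ideal B \<in> pverts (inclusion_ideal_graph R)"
        using bij_betwE[OF bij_betw_supported_ideal] that by blast+
      moreover have "A \<subseteq> {..<n}" "B \<subseteq> {..<n}" using that by auto
      ultimately show ?thesis
        by (simp add: inclusion_ideal_graph_def Let_def psubset_eq supported_ideal_subset_iff
            supported_ideal_eq_iff)
    qed
    show "pair_wf_digraph (inclusion_ideal_graph R)"
      by (rule pair_sym_digraph.axioms(1)[OF pair_bidirected_digraph.axioms(1)])
        (rule pair_bidirected_inclusion_ideal_graph)
  qed (use assms(1) bij_betw_supported_ideal in simp_all)
  \<comment> \<open>The witness is \<open>middle_graph\<close>, whose vertices are ideals because
    \<open>supported_ideal\<close> serves as \<open>\<phi>\<close>; the index set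
    \<open>{..<n}\<close> yields \<open>n\<close> copies.\<close>
  show ?thesis
    using connected_middle_graph strong_resolving_graph_iso by auto
qed

end
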